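(* Let $A\in\mathbb{R}^{n\times m}$ have rank $r$ and thin SVD $A=U\Sigma V^\top$, and let $u_i,v_j\in\mathbb{R}^r$ be the $i$th row of $U$ and the $j$th row of $V$. Let $I=(i_1,\ldots,i_k)$ and $J=(j_1,\ldots,j_k)$ be ordered tuples of row indices in $[n]$ and column indices in $[m]$, and assume that $S=A(I,J)$ is nonsingular. Define $$C=A(:,J),\qquad R=A(I,:),\qquad E=A-CS^{-1}R,$$ and let $u_I=u_{i_1}\wedge\cdots\wedge u_{i_k}$, $v_J=v_{j_1}\wedge\cdots\wedge v_{j_k}$. Then, for every $\ell\in[n]$ and $p\in[m]$, $$E_{\ell p}=\frac{\langle u_I\wedge u_\ell,\,v_J\wedge v_p\rangle_\sigma}{\det S}.$$ Suppose additionally that the weighted norms $\|u_{i_a}\|_\sigma$, $\|v_{j_b}\|_\sigma$ ($1\le a,b\le k$), $\|u_\ell\|_\sigma$ and $\|v_p\|_\sigma$ are all nonzero. Set $$\widehat u_i=\frac{u_i}{\|u_i\|_\sigma},\qquad \widehat v_j=\frac{v_j}{\|v_j\|_\sigma},\qquad \bar S_{ab}=\langle \widehat u_{i_a},\widehat v_{j_b}\rangle_\sigma .$$ Then $$E_{\ell p}=\frac{\|u_\ell\|_\sigma\,\|v_p\|_\sigma\,\langle\widehat u_I\wedge\widehat u_\ell,\;\widehat v_J\wedge\widehat v_p\rangle_\sigma}{\det\bar S},$$ where $\widehat u_I=\widehat u_{i_1}\wedge\cdots\wedge\widehat u_{i_k}$ and $\widehat v_J=\widehat v_{j_1}\wedge\cdots\wedge\widehat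 v_{j_k}$.
   Context: Thin SVD: $U\in\mathbb{R}^{n\times r}$ and $V\in\mathbb{R}^{m\times r}$ have orthonormal columns, $\Sigma=\operatorname{diag}(\sigma_1,\ldots,\sigma_r)$ with $\sigma_1\ge\cdots\ge\sigma_r>0$. For $x,y\in\mathbb{R}^r$, $\langle x,y\rangle_\sigma=x^\top\Sigma y=\sum_{q=1}^r\sigma_qx_qy_q$ and $\|x\|_\sigma=\sqrt{\langle x,x\rangle_\sigma}$. On the exterior power $\bigwedge^s\mathbb{R}^r$ the weighted inner product is defined on simple blades by $\langle x_1\wedge\cdots\wedge x_s,\,y_1\wedge\cdots\wedge y_s\rangle_\sigma=\det[\langle x_a,y_b\rangle_\sigma]_{a,b=1}^s$ and extended bilinearly. $A(I,J)$ is the $k\times k$ matrix with entries $A_{i_a j_b}$; $A(:,J)$ and $A(I,:)$ are the selected columns and rows, in the order given by the tuples. $[n]=\{1,\ldots,n\}$. *)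

theory Defs
  imports
    Jordan_Normal_Form.DL_Rank
    Jordan_Normal_Form.Gauss_Jordan_Elimination
    "HOL-Library.Poly_Mapping"
begin

section \<open>Thin singular value decompositions and submatrices\<close>

definition thin_svd ::
    "nat \<Rightarrow> nat \<Rightarrow> nat \<Rightarrow> real mat \<Rightarrow> real mat \<Rightarrow> (nat \<Rightarrow> real) \<Rightarrow> real mat \<Rightarrow> bool" where
  "thin_svd n m r A U \<sigma> V \<longleftrightarrow>
     U \<in> carrier_mat n r \<and> V \<in> carrier_mat m r \<and>
     U\<^sup>T * U = 1\<^sub>m r \<and> V\<^sup>T * V = 1\<^sub>m r \<and>
     (\<forall>p q. p \<le> q \<and> q < r \<longrightarrow> \<sigma> q \<le> \<sigma> p) \<and> (\<forall>q<r. 0 < \<sigma> q) \<and>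
     A = U * mat_diag r \<sigma> * V\<^sup>T"

text \<open>Rows and columns are taken in the order of the index lists.
  All indices start from 0.\<close>

definition sel_mat :: "'a mat \<Rightarrow> nat list \<Rightarrow> nat list \<Rightarrow> 'a mat" where
  "sel_mat A I J = mat (length I) (length J) (\<lambda>(a, b). A $$ (I ! a, J ! b))"

definition sel_cols :: "'a mat \<Rightarrow> nat list \<Rightarrow> 'a mat" where
  "sel_cols A J = sel_mat A [0..<dim_row A] J"

definition sel_rows :: "'a mat \<Rightarrow> nat list \<Rightarrow> 'a mat" where
  "sel_rows A I = sel_mat A I [0..<dim_col A]"


section \<open>The weighted inner product\<close>

text \<open>Vectors of unequal dimension never occur together in the intended use; the
  minimum only makes the form bilinear on all of them, so that it extends to the type
  of multivectors below.\<close>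

definition winner :: "(nat \<Rightarrow> real) \<Rightarrow> real vec \<Rightarrow> real vec \<Rightarrow> real" where
  "winner \<sigma> x y = (\<Sum>q<min (dim_vec x) (dim_vec y). \<sigma> q * x $ q * y $ q)"

definition wnorm :: "(nat \<Rightarrow> real) \<Rightarrow> real vec \<Rightarrow> real" where
  "wnorm \<sigma> x = sqrt (winner \<sigma> x x)"

lemma winner_eq_scalar_prod:
  assumes "x \<in> carrier_vec r" "y \<in> carrier_vec r"
  shows "winner \<sigma> x y = x \<bullet> (mat_diag r \<sigma> *\<^sub>v y)"
proof -
  have "(mat_diag r \<sigma> *\<^sub>v y) $ q = \<sigma> q * y $ q" if "q < r" for q
  proof -
    have "(mat_diag r \<sigma> *\<^sub>v y) $ q = (\<Sum>j<r. (if q = j then \<sigma> j else 0) * y $ j)"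
      using that assms(2) by (simp add: mat_diag_def scalar_prod_def lessThan_atLeast0)
    also have "\<dots> = (\<Sum>j<r. if q = j then \<sigma> j * y $ j else 0)"
      by (rule sum.cong) auto
    also have "\<dots> = \<sigma> q * y $ q" using that by simp
    finally show ?thesis .
  qed
  then show ?thesis
    using assms by (simp add: winner_def scalar_prod_def mat_diag_def lessThan_atLeast0 mult_ac)
qed

lemma winner_commute: "winner \<sigma> x y = winner \<sigma> y x"
  by (simp add: winner_def min.commute mult_ac)

lemma winner_add_left:
  "dim_vec x = dim_vec y \<Longrightarrow> winner \<sigma> (x + y) z = winner \<sigma> x z + winner \<sigma> y z"
  by (simp add: winner_def algebra_simps sum.distrib)

lemma winner_smult_left: "winner \<sigma> (c \<cdot>\<^sub>v x) z = c * winner \<sigma> x z"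
  by (simp add: winner_def sum_distrib_left mult_ac)


section \<open>Finitely supported functions as a free vector space\<close>

instantiation poly_mapping :: (type, real_vector) real_vector
begin

lift_definition scaleR_poly_mapping :: "real \<Rightarrow> ('a \<Rightarrow>\<^sub>0 'b) \<Rightarrow> 'a \<Rightarrow>\<^sub>0 'b"
  is "\<lambda>c f k. c *\<^sub>R f k"
  by (erule finite_subset[rotated]) auto

instance
  by standard (transfer; simp add: scaleR_add_right scaleR_add_left)+

end

definition lin_ext :: "('a \<Rightarrow> 'b::real_vector) \<Rightarrow> ('a \<Rightarrow>\<^sub>0 real) \<Rightarrow> 'b" where
  "lin_ext \<phi> f = (\<Sum>k\<in>Poly_Mapping.keys f. Poly_Mapping.lookup f k *\<^sub>R \<phi> k)"

lemma lin_ext_superset: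
  assumes "finite K" "Poly_Mapping.keys f \<subseteq> K"
  shows "lin_ext \<phi> f = (\<Sum>k\<in>K. Poly_Mapping.lookup f k *\<^sub>R \<phi> k)"
  unfolding lin_ext_def
  by (rule sum.mono_neutral_left[OF assms]) (auto simp: in_keys_iff)

lemma lookup_scaleR: "Poly_Mapping.lookup (c *\<^sub>R f) k = c *\<^sub>R Poly_Mapping.lookup f k"
  by transfer simp

lemma linear_lin_ext: "linear (lin_ext \<phi>)"
proof (rule linearI)
  fix f g :: "'a \<Rightarrow>\<^sub>0 real"
  let ?K = "Poly_Mapping.keys f \<union> Poly_Mapping.keys g"
  have "Poly_Mapping.keys (f + g) \<subseteq> ?K" by (rule Poly_Mapping.keys_add)
  then show "lin_ext \<phi> (f + g) = lin_ext \<phi> f + lin_ext \<phi> g"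
    by (simp add: lin_ext_superset[of ?K] lookup_add scaleR_add_left sum.distrib)
next
  fix c and f :: "'a \<Rightarrow>\<^sub>0 real"
  have "Poly_Mapping.keys (c *\<^sub>R f) \<subseteq> Poly_Mapping.keys f"
    by (auto simp: in_keys_iff lookup_scaleR)
  then show "lin_ext \<phi> (c *\<^sub>R f) = c *\<^sub>R lin_ext \<phi> f"
    by (simp add: lin_ext_superset[of "Poly_Mapping.keys f"] lookup_scaleR scaleR_sum_right)
qed

lemmas lin_ext_simps =
  linear_add[OF linear_lin_ext] linear_diff[OF linear_lin_ext]
  linear_scale[OF linear_lin_ext] linear_0[OF linear_lin_ext]

lemma lin_ext_single [simp]: "lin_ext \<phi> (Poly_Mapping.single k c) = c *\<^sub>R \<phi> k"
  by (simp add: lin_ext_def)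

lemma linear_lin_ext_param:
  assumes "\<And>k. linear (\<lambda>g. \<phi> k g)"
  shows "linear (\<lambda>g. lin_ext (\<lambda>k. \<phi> k g) f)"
  unfolding lin_ext_def
  by (intro linear_compose_sum ballI linear_compose_scale_right assms)


section \<open>Multivectors\<close>

text \<open>The exterior algebra as the quotient of the free vector space on lists of vectors
  (the list \<open>[x\<^sub>1, \<dots>, x\<^sub>s]\<close> standing for \<open>x\<^sub>1 \<and> \<dots> \<and> x\<^sub>s\<close>) by the relations that
  make the list multilinear and alternating in its entries. A single type serves all
  dimensions and degrees: linear relations are only imposed between vectors of equal dimension,
  so this is the exterior algebra of the direct sum of all spaces \<open>\<real>\<^sup>r\<close>, and the
  \<open>s\<close>-th exterior power of \<open>\<real>\<^sup>r\<close> is the subspace \<open>ext_power r s\<close> below.\<close>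

abbreviation formal :: "real vec list \<Rightarrow> (real vec list \<Rightarrow>\<^sub>0 real)" where
  "formal xs \<equiv> Poly_Mapping.single xs 1"

definition ext_relations :: "(real vec list \<Rightarrow>\<^sub>0 real) set" where
  "ext_relations =
     {formal (as @ (x + y) # bs) - formal (as @ x # bs) - formal (as @ y # bs) | as bs x y.
        dim_vec x = dim_vec y} \<union>
     {formal (as @ (c \<cdot>\<^sub>v x) # bs) - c *\<^sub>R formal (as @ x # bs) | as bs c x. True} \<union>
     {formal (as @ x # bs @ x # cs) | as bs cs x. True}"

lemma ext_relations_cases:
  assumes "h \<in> ext_relations"
  obtains
    (add) as bs x y where "dim_vec x = dim_vec y"
      "h = formal (as @ (x + y) # bs) - formal (as @ x # bs) - formal (as @ y # bs)"
  | (smult) as bs c x where "h = formal (as @ (c \<cdot>\<^sub>v x) # bs) - c *\<^sub>R formal (as @ x # bs)"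
  | (alt) as bs cs x where "h = formal (as @ x # bs @ x # cs)"
  using assms unfolding ext_relations_def by blast

lemma ext_relations_intros:
  "dim_vec x = dim_vec y \<Longrightarrow>
     formal (as @ (x + y) # bs) - formal (as @ x # bs) - formal (as @ y # bs) \<in> ext_relations"
  "formal (as @ (c \<cdot>\<^sub>v x) # bs) - c *\<^sub>R formal (as @ x # bs) \<in> ext_relations"
  "formal (as @ x # bs @ x # cs) \<in> ext_relations"
  unfolding ext_relations_def by blast+

definition ext_eq :: "(real vec list \<Rightarrow>\<^sub>0 real) \<Rightarrow> (real vec list \<Rightarrow>\<^sub>0 real) \<Rightarrow> bool" where
  "ext_eq f g \<longleftrightarrow> f - g \<in> span ext_relations"

quotient_type multivector = "real vec list \<Rightarrow>\<^sub>0 real" / ext_eq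
proof (rule equivpI)
  show "reflp ext_eq" by (simp add: reflp_def ext_eq_def span_zero)
  show "symp ext_eq" unfolding symp_def ext_eq_def by (metis minus_diff_eq span_neg)
  show "transp ext_eq"
  proof (rule transpI)
    fix f g h assume "ext_eq f g" "ext_eq g h"
    then have "(f - g) + (g - h) \<in> span ext_relations"
      unfolding ext_eq_def by (rule span_add)
    then show "ext_eq f h" by (simp add: ext_eq_def)
  qed
qed

lemma ext_eq_linear:
  assumes "linear L" "\<And>h. h \<in> ext_relations \<Longrightarrow> L h = 0" "ext_eq f g"
  shows "L f = L g"
proof -
  have "L (f - g) = 0"
    using linear_eq_0_on_span[OF assms(1)] assms(2,3) unfolding ext_eq_def by blast
  then show ?thesis by (simp add: linear_diff[OF assms(1)])
qed

instantiation multivector :: real_vector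
begin

lift_definition zero_multivector :: multivector is 0 .

lift_definition plus_multivector :: "multivector \<Rightarrow> multivector \<Rightarrow> multivector" is "(+)"
proof -
  fix f f' g g' assume "ext_eq f f'" "ext_eq g g'"
  then have "(f - f') + (g - g') \<in> span ext_relations" unfolding ext_eq_def by (rule span_add)
  then show "ext_eq (f + g) (f' + g')" by (simp add: ext_eq_def add_diff_add)
qed

lift_definition minus_multivector :: "multivector \<Rightarrow> multivector \<Rightarrow> multivector" is "(-)"
proof -
  fix f f' g g' assume "ext_eq f f'" "ext_eq g g'"
  then have "(f - f') - (g - g') \<in> span ext_relations" unfolding ext_eq_def by (rule span_diff)
  moreover have "(f - f') - (g - g') = (f - g) - (f' - g')" by (simp add: algebra_simps)
  ultimately show "ext_eq (f - g) (f' - g')" by (simp add: ext_eq_def)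
qed

lift_definition uminus_multivector :: "multivector \<Rightarrow> multivector" is uminus
proof -
  fix f f' assume "ext_eq f f'"
  then have "- (f - f') \<in> span ext_relations" unfolding ext_eq_def by (rule span_neg)
  then show "ext_eq (- f) (- f')" by (simp add: ext_eq_def)
qed

lift_definition scaleR_multivector :: "real \<Rightarrow> multivector \<Rightarrow> multivector" is scaleR
proof -
  fix c :: real and f f' assume "ext_eq f f'"
  then have "c *\<^sub>R (f - f') \<in> span ext_relations" unfolding ext_eq_def by (rule span_scale)
  then show "ext_eq (c *\<^sub>R f) (c *\<^sub>R f')" by (simp add: ext_eq_def scaleR_diff_right)
qed

instance
  by standard (transfer; simp add: ext_eq_def span_zero scaleR_add_left scaleR_add_right add_ac)+

end

lift_definition blade :: "real vec list \<Rightarrow> multivector" is formal .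

definition ext_power :: "nat \<Rightarrow> nat \<Rightarrow> multivector set" where
  "ext_power r s = span {blade xs | xs. length xs = s \<and> set xs \<subseteq> carrier_vec r}"

lemma blade_in_ext_power: "set xs \<subseteq> carrier_vec r \<Longrightarrow> blade xs \<in> ext_power r (length xs)"
  unfolding ext_power_def by (rule span_base) blast

lemma blade_add:
  "dim_vec x = dim_vec y \<Longrightarrow> blade (as @ (x + y) # bs) = blade (as @ x # bs) + blade (as @ y # bs)"
  by transfer (simp add: ext_eq_def diff_diff_eq[symmetric] span_base ext_relations_intros)

lemma blade_smult: "blade (as @ (c \<cdot>\<^sub>v x) # bs) = c *\<^sub>R blade (as @ x # bs)"
  by transfer (simp add: ext_eq_def span_base ext_relations_intros)

lemma blade_repeat: "blade (as @ x # bs @ x # cs) = 0"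
  by transfer (simp add: ext_eq_def span_base ext_relations_intros)


subsection \<open>The wedge product\<close>

definition formal_wedge ::
    "(real vec list \<Rightarrow>\<^sub>0 real) \<Rightarrow> (real vec list \<Rightarrow>\<^sub>0 real) \<Rightarrow> (real vec list \<Rightarrow>\<^sub>0 real)" where
  "formal_wedge f g = lin_ext (\<lambda>xs. lin_ext (\<lambda>ys. formal (xs @ ys)) g) f"

lemma linear_formal_wedge:
  "linear (\<lambda>f. formal_wedge f g)" "linear (\<lambda>g. formal_wedge f g)"
  unfolding formal_wedge_def by (intro linear_lin_ext linear_lin_ext_param)+

lemma formal_wedge_relation_left:
  assumes "h \<in> ext_relations"
  shows "formal_wedge h (formal ys) \<in> span ext_relations"
  using assms
proof (cases rule: ext_relations_cases)
  case (add as bs x y)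
  then show ?thesis
    using ext_relations_intros(1)[of x y as "bs @ ys"]
    by (simp add: formal_wedge_def lin_ext_simps span_base)
next
  case (smult as bs c x)
  then show ?thesis
    using ext_relations_intros(2)[of as c x "bs @ ys"]
    by (simp add: formal_wedge_def lin_ext_simps span_base)
next
  case (alt as bs cs x)
  then show ?thesis
    using ext_relations_intros(3)[of as x bs "cs @ ys"]
    by (simp add: formal_wedge_def lin_ext_simps span_base)
qed

lemma formal_wedge_relation_right:
  assumes "h \<in> ext_relations"
  shows "formal_wedge (formal xs) h \<in> span ext_relations"
  using assms
proof (cases rule: ext_relations_cases)
  case (add as bs x y)
  then show ?thesis
    using ext_relations_intros(1)[of x y "xs @ as" bs]
    by (simp add: formal_wedge_def lin_ext_simps span_base)
next
  case (smult as bs c x)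
  then show ?thesis
    using ext_relations_intros(2)[of "xs @ as" c x bs]
    by (simp add: formal_wedge_def lin_ext_simps span_base)
next
  case (alt as bs cs x)
  then show ?thesis
    using ext_relations_intros(3)[of "xs @ as" x bs cs]
    by (simp add: formal_wedge_def lin_ext_simps span_base)
qed

lemma linear_span_into:
  assumes "linear L" "\<And>h. h \<in> B \<Longrightarrow> L h \<in> span C" "f \<in> span B"
  shows "L f \<in> span C"
proof -
  have "span (L ` B) \<subseteq> span C"
    by (rule span_minimal) (use assms(2) in auto)
  moreover have "L f \<in> span (L ` B)"
    using assms(3) linear_span_image[OF assms(1), of B] by auto
  ultimately show ?thesis by blast
qed

lemma poly_mapping_linear_induct:
  fixes f :: "'a \<Rightarrow>\<^sub>0 real"
  assumes "linear L" "\<And>k. L (Poly_Mapping.single k 1) \<in> span C"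
  shows "L f \<in> span C"
proof (induction f rule: update_induct)
  case const
  then show ?case by (simp add: linear_0[OF assms(1)] span_zero)
next
  case (update f a b)
  have eq: "Poly_Mapping.update a b f = f + b *\<^sub>R Poly_Mapping.single a 1"
  proof (rule poly_mapping_eqI)
    fix k
    show "Poly_Mapping.lookup (Poly_Mapping.update a b f) k = Poly_Mapping.lookup (f + b *\<^sub>R Poly_Mapping.single a 1) k"
      using update(1)
      by (auto simp: lookup_update lookup_add lookup_scaleR lookup_single when_def in_keys_iff)
  qed
  show ?case
    unfolding eq linear_add[OF assms(1)] linear_scale[OF assms(1)]
    by (intro span_add span_scale update assms)
qed

lift_definition wedge :: "multivector \<Rightarrow> multivector \<Rightarrow> multivector" (infixl "\<^bold>\<and>" 70)
  is formal_wedge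
proof -
  fix f f' g g' :: "real vec list \<Rightarrow>\<^sub>0 real"
  assume f: "ext_eq f f'" and g: "ext_eq g g'"
  have "formal_wedge (f - f') (formal ys) \<in> span ext_relations" for ys
    using linear_span_into[OF linear_formal_wedge(1)] formal_wedge_relation_left f
    unfolding ext_eq_def by blast
  then have 1: "formal_wedge (f - f') g \<in> span ext_relations"
    by (rule poly_mapping_linear_induct[OF linear_formal_wedge(2)])
  have "formal_wedge (formal xs) (g - g') \<in> span ext_relations" for xs
    using linear_span_into[OF linear_formal_wedge(2)] formal_wedge_relation_right g
    unfolding ext_eq_def by blast
  then have 2: "formal_wedge f' (g - g') \<in> span ext_relations"
    by (rule poly_mapping_linear_induct[OF linear_formal_wedge(1)])
  have "formal_wedge f g - formal_wedge f' g' = formal_wedge (f - f') g + formal_wedge f' (g - g')"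
    by (simp add: linear_diff[OF linear_formal_wedge(1)] linear_diff[OF linear_formal_wedge(2)])
  then show "ext_eq (formal_wedge f g) (formal_wedge f' g')"
    unfolding ext_eq_def using span_add[OF 1 2] by simp
qed

lemma wedge_blade [simp]: "blade xs \<^bold>\<and> blade ys = blade (xs @ ys)"
  by transfer (simp add: formal_wedge_def ext_eq_def span_zero)

lemma linear_wedge: "linear (\<lambda>\<omega>. \<omega> \<^bold>\<and> \<eta>)" "linear (\<lambda>\<eta>. \<omega> \<^bold>\<and> \<eta>)"
  by (rule linearI; transfer;
      simp add: linear_add[OF linear_formal_wedge(1)] linear_add[OF linear_formal_wedge(2)]
        linear_scale[OF linear_formal_wedge(1)] linear_scale[OF linear_formal_wedge(2)]
        ext_eq_def span_zero)+


subsection \<open>The weighted inner product of multivectors\<close>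

definition gram_det :: "(nat \<Rightarrow> real) \<Rightarrow> real vec list \<Rightarrow> real vec list \<Rightarrow> real" where
  "gram_det \<sigma> xs ys =
     (if length xs = length ys
      then det (mat (length xs) (length xs) (\<lambda>(a, b). winner \<sigma> (xs ! a) (ys ! b)))
      else 0)"

definition formal_inner ::
    "(nat \<Rightarrow> real) \<Rightarrow> (real vec list \<Rightarrow>\<^sub>0 real) \<Rightarrow> (real vec list \<Rightarrow>\<^sub>0 real) \<Rightarrow> real" where
  "formal_inner \<sigma> f g = lin_ext (\<lambda>xs. lin_ext (\<lambda>ys. gram_det \<sigma> xs ys) g) f"

lemma gram_det_commute: "gram_det \<sigma> xs ys = gram_det \<sigma> ys xs"
proof (cases "length xs = length ys")
  case True
  let ?M = "mat (length xs) (length xs) (\<lambda>(a, b). winner \<sigma> (xs ! a) (ys ! b))"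
  have "?M\<^sup>T = mat (length ys) (length ys) (\<lambda>(a, b). winner \<sigma> (ys ! a) (xs ! b))"
    using True by (intro eq_matI) (auto simp: winner_commute)
  then show ?thesis
    using True det_transpose[of ?M "length xs"] by (simp add: gram_det_def)
qed (simp add: gram_det_def)

lemma gram_det_expand:
  assumes "length as + 1 + length bs = length ys"
  shows "gram_det \<sigma> (as @ x # bs) ys =
    (\<Sum>j<length ys. winner \<sigma> x (ys ! j) *
       cofactor (mat (length ys) (length ys) (\<lambda>(a, b). winner \<sigma> ((as @ z # bs) ! a) (ys ! b)))
         (length as) j)"
proof -
  let ?n = "length ys" and ?i = "length as"
  let ?M = "\<lambda>x. mat ?n ?n (\<lambda>(a, b). winner \<sigma> ((as @ x # bs) ! a) (ys ! b))"
  have i: "?i < ?n" using assms by simp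
  have del: "mat_delete (?M x) ?i j = mat_delete (?M z) ?i j" if "j < ?n" for j
    by (rule eq_matI) (auto simp: mat_delete_def nth_append)
  have "gram_det \<sigma> (as @ x # bs) ys = det (?M x)"
    using assms by (simp add: gram_det_def)
  also have "\<dots> = (\<Sum>j<?n. ?M x $$ (?i, j) * cofactor (?M x) ?i j)"
    by (rule laplace_expansion_row) (use i in auto)
  also have "\<dots> = (\<Sum>j<?n. winner \<sigma> x (ys ! j) * cofactor (?M z) ?i j)"
  proof (rule sum.cong[OF refl])
    fix j assume "j \<in> {..<?n}"
    then have j: "j < ?n" by simp
    have "?M x $$ (?i, j) = winner \<sigma> x (ys ! j)" using i j by simp
    moreover have "cofactor (?M x) ?i j = cofactor (?M z) ?i j"
      unfolding cofactor_def del[OF j] by (rule refl)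
    ultimately show "?M x $$ (?i, j) * cofactor (?M x) ?i j =
        winner \<sigma> x (ys ! j) * cofactor (?M z) ?i j" by simp
  qed
  finally show ?thesis .
qed

lemma gram_det_add_left:
  assumes "dim_vec x = dim_vec y"
  shows "gram_det \<sigma> (as @ (x + y) # bs) zs = gram_det \<sigma> (as @ x # bs) zs + gram_det \<sigma> (as @ y # bs) zs"
proof (cases "length as + 1 + length bs = length zs")
  case True
  show ?thesis
    unfolding gram_det_expand[OF True, where z = x] sum.distrib[symmetric]
    by (simp add: winner_add_left[OF assms] algebra_simps)
qed (simp add: gram_det_def)

lemma gram_det_smult_left: "gram_det \<sigma> (as @ (c \<cdot>\<^sub>v x) # bs) zs = c * gram_det \<sigma> (as @ x # bs) zs"
proof (cases "length as + 1 + length bs = length zs")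
  case True
  show ?thesis
    unfolding gram_det_expand[OF True, where z = x] sum_distrib_left
    by (simp add: winner_smult_left mult_ac)
qed (simp add: gram_det_def)

lemma gram_det_repeat_left: "gram_det \<sigma> (as @ x # bs @ x # cs) zs = 0"
proof (cases "length (as @ x # bs @ x # cs) = length zs")
  case True
  let ?xs = "as @ x # bs @ x # cs"
  let ?i = "length as" and ?j = "length as + 1 + length bs"
  have x: "?xs ! ?i = x" "?xs ! ?j = x" by (simp_all add: nth_append)
  have ij: "?i < length zs" "?j < length zs" unfolding True[symmetric] by simp_all
  let ?M = "mat (length zs) (length zs) (\<lambda>(a, b). winner \<sigma> (?xs ! a) (zs ! b))"
  have "row ?M ?i = row ?M ?j"
    by (rule eq_vecI) (simp_all only: row_mat ij x case_prod_conv dim_vec index_vec index_row dim_row_mat dim_col_mat index_mat)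
  then have "det ?M = 0"
    using ij by (intro det_identical_rows[of ?M "length zs" ?i ?j]) simp_all
  then show ?thesis unfolding gram_det_def True by (simp only: if_True simp_thms)
qed (simp add: gram_det_def)

lemma linear_formal_inner:
  "linear (\<lambda>f. formal_inner \<sigma> f g)" "linear (\<lambda>g. formal_inner \<sigma> f g)"
  unfolding formal_inner_def by (intro linear_lin_ext linear_lin_ext_param)+

lemma formal_inner_commute: "formal_inner \<sigma> f g = formal_inner \<sigma> g f"
  unfolding formal_inner_def lin_ext_def real_scaleR_def sum_distrib_left
  by (subst sum.swap) (simp add: mult_ac gram_det_commute)

lemma formal_inner_relation_left:
  assumes "h \<in> ext_relations"
  shows "formal_inner \<sigma> h g = 0"
proof -
  have 1: "(\<Sum>ys\<in>Poly_Mapping.keys g. Poly_Mapping.lookup g ys * lin_ext (\<lambda>xs. gram_det \<sigma> xs ys) h) = 0"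
  proof (rule sum.neutral, intro ballI)
    fix ys
    show "Poly_Mapping.lookup g ys * lin_ext (\<lambda>xs. gram_det \<sigma> xs ys) h = 0"
      using assms
      by (cases rule: ext_relations_cases)
        (simp_all add: lin_ext_simps gram_det_add_left gram_det_smult_left gram_det_repeat_left)
  qed
  have "formal_inner \<sigma> h g = formal_inner \<sigma> g h" by (rule formal_inner_commute)
  also have "\<dots> = (\<Sum>ys\<in>Poly_Mapping.keys g.
      Poly_Mapping.lookup g ys * lin_ext (\<lambda>xs. gram_det \<sigma> xs ys) h)"
    unfolding formal_inner_def lin_ext_def[of _ g] real_scaleR_def
    by (subst gram_det_commute) (rule refl)
  finally show ?thesis using 1 by simp
qed

lift_definition ext_inner :: "(nat \<Rightarrow> real) \<Rightarrow> multivector \<Rightarrow> multivector \<Rightarrow> real"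
  is formal_inner
proof -
  fix \<sigma> and f f' g g' :: "real vec list \<Rightarrow>\<^sub>0 real"
  assume f: "ext_eq f f'" and g: "ext_eq g g'"
  have "formal_inner \<sigma> f g = formal_inner \<sigma> f' g"
    using ext_eq_linear[where L = "\<lambda>h. formal_inner \<sigma> h g", OF linear_formal_inner(1) _ f]
    by (simp only: formal_inner_relation_left)
  also have "\<dots> = formal_inner \<sigma> g f'" by (rule formal_inner_commute)
  also have "\<dots> = formal_inner \<sigma> g' f'"
    using ext_eq_linear[where L = "\<lambda>h. formal_inner \<sigma> h f'", OF linear_formal_inner(1) _ g]
    by (simp only: formal_inner_relation_left)
  also have "\<dots> = formal_inner \<sigma> f' g'" by (rule formal_inner_commute)
  finally show "formal_inner \<sigma> f g = formal_inner \<sigma> f' g'" .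
qed

lemma ext_inner_blade_gram: "ext_inner \<sigma> (blade xs) (blade ys) = gram_det \<sigma> xs ys"
  by (simp add: ext_inner.abs_eq blade.abs_eq formal_inner_def)

lemma ext_inner_blade:
  assumes "length xs = s" "length ys = s"
  shows "ext_inner \<sigma> (blade xs) (blade ys) = det (mat s s (\<lambda>(a, b). winner \<sigma> (xs ! a) (ys ! b)))"
  using assms by (simp add: ext_inner_blade_gram gram_det_def)

lemma linear_ext_inner:
  "linear (\<lambda>\<omega>. ext_inner \<sigma> \<omega> \<eta>)" "linear (\<lambda>\<eta>. ext_inner \<sigma> \<omega> \<eta>)"
proof -
  have "ext_inner \<sigma> (\<omega> + \<omega>') \<eta> = ext_inner \<sigma> \<omega> \<eta> + ext_inner \<sigma> \<omega>' \<eta>" for \<omega> \<omega>' \<eta>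
    by (transfer fixing: \<sigma>) (rule linear_add[OF linear_formal_inner(1)])
  moreover have "ext_inner \<sigma> (c *\<^sub>R \<omega>) \<eta> = c *\<^sub>R ext_inner \<sigma> \<omega> \<eta>" for c \<omega> \<eta>
    by (transfer fixing: \<sigma> c) (rule linear_scale[OF linear_formal_inner(1)])
  ultimately show left: "linear (\<lambda>\<omega>. ext_inner \<sigma> \<omega> \<eta>)" for \<eta>
    by (intro linearI)
  have "ext_inner \<sigma> \<omega> \<eta> = ext_inner \<sigma> \<eta> \<omega>" for \<omega> \<eta>
    by (transfer fixing: \<sigma>) (rule formal_inner_commute)
  then show "linear (\<lambda>\<eta>. ext_inner \<sigma> \<omega> \<eta>)"
    using left[of \<omega>] by simp
qed

end

theory Submission
  imports Defs
begin

text \<open>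
  Since \<open>A = U \<Sigma> V\<^sup>T\<close>, every entry of \<open>A\<close> is a weighted inner product of a row of
  \<open>U\<close> with a row of \<open>V\<close> (\<open>thin_svd_entry\<close>). Hence the Gram determinant
  \<open>\<langle>u\<^sub>I \<and> u\<^sub>l, v\<^sub>J \<and> v\<^sub>p\<rangle>\<^sub>\<sigma>\<close> is the determinant of the matrix \<open>S = A(I, J)\<close>
  bordered by the row \<open>A(l, J)\<close>, the column \<open>A(I, p)\<close> and the corner \<open>A(l, p)\<close>. The Schur
  complement of \<open>S\<close> in this matrix is the scalar \<open>A(l, p) - A(l, J) S\<^sup>-\<^sup>1 A(I, p)\<close>, which
  is \<open>E(l, p)\<close>, so the bordered determinant equals \<open>det S * E(l, p)\<close>
  (\<open>det_four_block_schur\<close>, \<open>bordered_det_eq_residual\<close>).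

  The normalised formula is the first one rescaled: replacing the vectors by multiples of
  themselves multiplies a Gram determinant by all the factors (\<open>det_scale_rows_cols\<close>), and
  the factors belonging to \<open>I\<close> and \<open>J\<close> cancel between numerator and denominator, leaving
  those of \<open>u\<^sub>l\<close> and \<open>v\<^sub>p\<close>.
\<close>

lemma det_four_block_schur:
  fixes S :: "'a :: idom mat"
  assumes S: "S \<in> carrier_mat k k" and T: "T \<in> carrier_mat k k"
    and B: "B \<in> carrier_mat k q" and C: "C \<in> carrier_mat q k" and D: "D \<in> carrier_mat q q"
    and inv: "T * S = 1\<^sub>m k"
  shows "det (four_block_mat S B C D) = det S * det (D - C * T * B)"
proof -
  \<comment> \<open>Block elimination: clear the lower left block by left multiplication with a unipotent matrix.\<close>
  let ?L = "four_block_mat (1\<^sub>m k) (0\<^sub>m k q) (- (C * T)) (1\<^sub>m q)"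
  have CT: "C * T \<in> carrier_mat q k" using C T by simp
  have CTB: "C * T * B \<in> carrier_mat q q" using CT B by simp
  have "C * T * S = C"
    using assoc_mult_mat[OF C T S] inv C by simp
  then have "- (C * T) * S + 1\<^sub>m q * C = 0\<^sub>m q k"
    using T S C by simp
  moreover have "- (C * T) * B + 1\<^sub>m q * D = D - C * T * B"
    using CTB T B C D minus_add_uminus_mat[OF D CTB] comm_add_mat[of "- (C * T * B)" q q D]
    by simp
  ultimately have LM: "?L * four_block_mat S B C D =
      four_block_mat S B (0\<^sub>m q k) (D - C * T * B)"
    using mult_four_block_mat[of "1\<^sub>m k" k k "0\<^sub>m k q" q "- (C * T)" q "1\<^sub>m q" S k B q C D] assms CT
    by simp
  have "det ?L = 1"
    using det_four_block_mat_upper_right_zero[OF one_carrier_mat[of k] refl _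
        one_carrier_mat[of q], of "- (C * T)"] CT
    by simp
  then have "det (four_block_mat S B C D) = det (?L * four_block_mat S B C D)"
    using det_mult[of ?L "k + q" "four_block_mat S B C D"] S D by simp
  also have "\<dots> = det S * det (D - C * T * B)"
    unfolding LM
    by (rule det_four_block_mat_lower_left_zero[OF S B refl minus_carrier_mat[OF CTB]])
  finally show ?thesis .
qed

lemma det_mat_diag: "det (mat_diag n f :: 'a :: comm_ring_1 mat) = (\<Prod>i<n. f i)"
proof -
  have "det (mat_diag n f) = prod_list (diag_mat (mat_diag n f))"
    by (rule det_upper_triangular[where n = n]) (auto simp: mat_diag_def)
  also have "diag_mat (mat_diag n f) = map f [0..<n]"
    by (simp add: diag_mat_def mat_diag_def)
  also have "prod_list \<dots> = (\<Prod>i<n. f i)"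
    by (simp add: prod.list_conv_set_nth lessThan_atLeast0)
  finally show ?thesis .
qed

lemma det_scale_rows_cols:
  fixes X :: "nat \<Rightarrow> nat \<Rightarrow> 'a :: comm_ring_1"
  shows "det (mat n n (\<lambda>(i, j). f i * g j * X i j)) =
    (\<Prod>i<n. f i) * (\<Prod>j<n. g j) * det (mat n n (\<lambda>(i, j). X i j))"
proof -
  let ?X = "mat n n (\<lambda>(i, j). X i j)"
  have "mat n n (\<lambda>(i, j). f i * g j * X i j) = mat_diag n f * (?X * mat_diag n g)"
    by (subst mat_diag_mult_right[of _ n], simp, subst mat_diag_mult_left[of _ n n])
      (auto intro!: eq_matI simp: mult_ac)
  moreover have "det (mat_diag n f * (?X * mat_diag n g)) =
      det (mat_diag n f) * (det ?X * det (mat_diag n g))"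
    using det_mult[of "mat_diag n f" n "?X * mat_diag n g"] det_mult[of ?X n "mat_diag n g"]
    by (simp only: mat_diag_dim mat_carrier mult_carrier_mat[of _ n n])
  ultimately show ?thesis
    by (simp add: det_mat_diag mult_ac)
qed

lemma mat_inverse_invertible_mat:
  fixes S :: "'a :: field mat"
  assumes S: "S \<in> carrier_mat k k" and inv: "invertible_mat S"
  shows "the (mat_inverse S) \<in> carrier_mat k k"
    and "S * the (mat_inverse S) = 1\<^sub>m k" and "the (mat_inverse S) * S = 1\<^sub>m k"
proof -
  obtain B where "S * B = 1\<^sub>m k" "B * S = 1\<^sub>m (dim_row B)"
    using S inv by (auto simp: invertible_mat_def inverts_mat_def)
  moreover from this have "B \<in> carrier_mat k k"
    using S by (metis carrier_matD(2) carrier_matI index_mult_mat(3) index_one_mat(3))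
  ultimately have "S \<in> Units (ring_mat TYPE('a) k ())"
    using S by (auto simp: Units_def ring_mat_def)
  then obtain T where T: "mat_inverse S = Some T"
    using mat_inverse(1)[OF S, where b = "()"] by (cases "mat_inverse S") auto
  with mat_inverse(2)[OF S T]
  show "the (mat_inverse S) \<in> carrier_mat k k"
    and "S * the (mat_inverse S) = 1\<^sub>m k" and "the (mat_inverse S) * S = 1\<^sub>m k"
    by simp_all
qed

lemma thin_svd_entry:
  assumes "thin_svd n m r A U \<sigma> V" "i < n" "j < m"
  shows "A $$ (i, j) = winner \<sigma> (row U i) (row V j)"
proof -
  have U: "U \<in> carrier_mat n r" and V: "V \<in> carrier_mat m r"
    and A: "A = U * mat_diag r \<sigma> * V\<^sup>T"
    using assms(1) by (auto simp: thin_svd_def)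
  have "U * mat_diag r \<sigma> = mat n r (\<lambda>(i, q). U $$ (i, q) * \<sigma> q)"
    using mat_diag_mult_right[OF U] .
  then show ?thesis
    unfolding A using assms(2,3) U V
    by (simp add: scalar_prod_def winner_def lessThan_atLeast0 mult_ac)
qed

lemma sel_mat_snoc:
  "sel_mat A (I @ [l]) (J @ [p]) =
    four_block_mat (sel_mat A I J) (sel_mat A I [p]) (sel_mat A [l] J) (sel_mat A [l] [p])"
  by (rule eq_matI) (auto simp: sel_mat_def nth_append less_Suc_eq)

text \<open>The entry of the residual \<open>A - C S\<^sup>-\<^sup>1 R\<close> of a cross approximation is a Schur complement.\<close>

lemma bordered_det_eq_residual:
  fixes A :: "'a :: field mat"
  assumes A: "A \<in> carrier_mat n m" and len: "length I = length J"
    and inv: "invertible_mat (sel_mat A I J)" and lp: "l < n" "p < m"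
  shows "det (sel_mat A (I @ [l]) (J @ [p])) = det (sel_mat A I J) *
    (A - sel_cols A J * the (mat_inverse (sel_mat A I J)) * sel_rows A I) $$ (l, p)"
proof -
  let ?k = "length J"
  let ?T = "the (mat_inverse (sel_mat A I J))"
  let ?b = "sel_mat A I [p]" and ?c = "sel_mat A [l] J" and ?d = "sel_mat A [l] [p]"
  have S: "sel_mat A I J \<in> carrier_mat ?k ?k" using len by (simp add: sel_mat_def)
  note T = mat_inverse_invertible_mat[OF S inv]
  have b: "?b \<in> carrier_mat ?k 1" and c: "?c \<in> carrier_mat 1 ?k" and d: "?d \<in> carrier_mat 1 1"
    using len by (simp_all add: sel_mat_def)
  have C: "sel_cols A J \<in> carrier_mat n ?k" and R: "sel_rows A I \<in> carrier_mat ?k m"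
    using A len by (simp_all add: sel_cols_def sel_rows_def sel_mat_def)
  have "row (sel_cols A J) l = row ?c 0" "col (sel_rows A I) p = col ?b 0"
    using A len lp by (auto intro!: eq_vecI simp: sel_cols_def sel_rows_def sel_mat_def)
  moreover from this have "row (sel_cols A J * ?T) l = row (?c * ?T) 0"
    using lp C c T(1) by (intro eq_vecI) auto
  ultimately have CTR: "(sel_cols A J * ?T * sel_rows A I) $$ (l, p) = (?c * ?T * ?b) $$ (0, 0)"
    using lp C R T(1) b c by simp
  have entry: "?d $$ (0, 0) = A $$ (l, p)"
    by (simp add: sel_mat_def)
  have "det (?d - ?c * ?T * ?b) = (?d - ?c * ?T * ?b) $$ (0, 0)"
    by (rule det_single) (use b c d T(1) in \<open>auto intro!: minus_carrier_mat mult_carrier_mat\<close>)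
  also have "\<dots> = (A - sel_cols A J * ?T * sel_rows A I) $$ (l, p)"
    using index_minus_mat(1)[of 0 "?c * ?T * ?b" 0 ?d]
      index_minus_mat(1)[of l "sel_cols A J * ?T * sel_rows A I" p A] CTR entry lp C R b c
    by (simp only: carrier_matD index_mult_mat less_numeral_extra)
  finally show ?thesis
    unfolding sel_mat_snoc
    using det_four_block_schur[OF S T(1) b c d T(3)] by simp
qed

lemma winner_smult_smult: "winner \<sigma> (a \<cdot>\<^sub>v x) (b \<cdot>\<^sub>v y) = a * b * winner \<sigma> x y"
  by (metis mult.assoc winner_commute winner_smult_left)

theorem theorem2p1:
  fixes A U V S C R E :: "real mat" and \<sigma> :: "nat \<Rightarrow> real"
    and n m r k l p :: nat and I J :: "nat list"
    and u v u' v' :: "nat \<Rightarrow> real vec"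
  assumes "A \<in> carrier_mat n m"
    and "vec_space.rank n A = r"
    and "thin_svd n m r A U \<sigma> V"
    and "\<And>i. u i = row U i"
    and "\<And>j. v j = row V j"
    and "length I = k" and "set I \<subseteq> {..<n}"
    and "length J = k" and "set J \<subseteq> {..<m}"
    and "S = sel_mat A I J"
    and "invertible_mat S"
    and "C = sel_cols A J"
    and "R = sel_rows A I"
    and "E = A - C * the (mat_inverse S) * R"
    and "\<And>i. u' i = (1 / wnorm \<sigma> (u i)) \<cdot>\<^sub>v u i"
    and "\<And>j. v' j = (1 / wnorm \<sigma> (v j)) \<cdot>\<^sub>v v j"
    and "l < n" and "p < m"
  shows "E $$ (l, p) =
           ext_inner \<sigma> (blade (map u I) \<^bold>\<and> blade [u l]) (blade (map v J) \<^bold>\<and> blade [v p]) / det S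
    \<and> ((\<forall>a<k. wnorm \<sigma> (u (I ! a)) \<noteq> 0) \<and> (\<forall>b<k. wnorm \<sigma> (v (J ! b)) \<noteq> 0) \<and>
         wnorm \<sigma> (u l) \<noteq> 0 \<and> wnorm \<sigma> (v p) \<noteq> 0 \<longrightarrow>
       E $$ (l, p) =
         wnorm \<sigma> (u l) * wnorm \<sigma> (v p) *
         ext_inner \<sigma> (blade (map u' I) \<^bold>\<and> blade [u' l]) (blade (map v' J) \<^bold>\<and> blade [v' p]) /
         det (mat k k (\<lambda>(a, b). winner \<sigma> (u' (I ! a)) (v' (J ! b)))))"
proof -
  let ?K = "I @ [l]" and ?L = "J @ [p]"
  let ?G = "\<lambda>a b. winner \<sigma> (u (?K ! a)) (v (?L ! b))"
  let ?M = "det (mat (Suc k) (Suc k) (\<lambda>(a, b). ?G a b))"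
  have bounds: "I ! a < n" "J ! a < m" if "a < k" for a
    using that assms(6-9) by (auto dest!: subsetD[OF _ nth_mem])
  have "?K ! a < n" "?L ! a < m" if "a < Suc k" for a
    using that bounds assms(6,8,17,18) by (auto simp: nth_append less_Suc_eq)
  then have "sel_mat A ?K ?L = mat (Suc k) (Suc k) (\<lambda>(a, b). ?G a b)"
    using assms(6,8) thin_svd_entry[OF assms(3)]
    by (intro eq_matI) (auto simp: sel_mat_def assms(4,5))
  moreover have S: "S = mat k k (\<lambda>(a, b). ?G a b)"
    using bounds assms(6,8) thin_svd_entry[OF assms(3)]
    by (intro eq_matI) (auto simp: assms(10) sel_mat_def assms(4,5) nth_append)
  ultimately have M: "?M = det S * E $$ (l, p)"
    using bordered_det_eq_residual[of A n m I J l p] assms by simp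
  have "det S \<noteq> 0"
  proof -
    have Sc: "S \<in> carrier_mat k k" unfolding S by simp
    note T = mat_inverse_invertible_mat[OF Sc assms(11)]
    have "det S * det (the (mat_inverse S)) = 1"
      using det_mult[OF Sc T(1)] T(2) by simp
    then show ?thesis by auto
  qed
  with M have E: "E $$ (l, p) = ?M / det S" by simp
  have inner: "ext_inner \<sigma> (blade (map x I) \<^bold>\<and> blade [x l]) (blade (map y J) \<^bold>\<and> blade [y p]) =
      det (mat (Suc k) (Suc k) (\<lambda>(a, b). winner \<sigma> (x (?K ! a)) (y (?L ! b))))" for x y
  proof -
    have "blade (map x I) \<^bold>\<and> blade [x l] = blade (map x ?K)"
      "blade (map y J) \<^bold>\<and> blade [y p] = blade (map y ?L)"
      by simp_all
    moreover have "mat (Suc k) (Suc k) (\<lambda>(a, b). winner \<sigma> (map x ?K ! a) (map y ?L ! b)) =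
        mat (Suc k) (Suc k) (\<lambda>(a, b). winner \<sigma> (x (?K ! a)) (y (?L ! b)))"
      using assms(6,8) by (intro eq_matI) (simp_all del: map_append)
    ultimately show ?thesis
      using ext_inner_blade[of "map x ?K" "Suc k" "map y ?L" \<sigma>] assms(6,8)
      by (simp only: length_map length_append list.size)
  qed
  show ?thesis
  proof (intro conjI impI)
    show "E $$ (l, p) =
        ext_inner \<sigma> (blade (map u I) \<^bold>\<and> blade [u l]) (blade (map v J) \<^bold>\<and> blade [v p]) / det S"
      unfolding inner by (rule E)
  next
    assume nz: "(\<forall>a<k. wnorm \<sigma> (u (I ! a)) \<noteq> 0) \<and> (\<forall>b<k. wnorm \<sigma> (v (J ! b)) \<noteq> 0) \<and>
      wnorm \<sigma> (u l) \<noteq> 0 \<and> wnorm \<sigma> (v p) \<noteq> 0"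
    let ?f = "\<lambda>a. 1 / wnorm \<sigma> (u (?K ! a))" and ?g = "\<lambda>b. 1 / wnorm \<sigma> (v (?L ! b))"
    let ?F = "\<Prod>a<k. ?f a" and ?H = "\<Prod>b<k. ?g b"
    have scale: "det (mat q q (\<lambda>(a, b). winner \<sigma> (u' (?K ! a)) (v' (?L ! b)))) =
        (\<Prod>a<q. ?f a) * (\<Prod>b<q. ?g b) * det (mat q q (\<lambda>(a, b). ?G a b))" for q
      unfolding assms(15,16) winner_smult_smult by (rule det_scale_rows_cols)
    have "mat k k (\<lambda>(a, b). winner \<sigma> (u' (I ! a)) (v' (J ! b))) =
        mat k k (\<lambda>(a, b). winner \<sigma> (u' (?K ! a)) (v' (?L ! b)))"
      using assms(6,8) by (intro eq_matI) (auto simp: nth_append)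
    then have den: "det (mat k k (\<lambda>(a, b). winner \<sigma> (u' (I ! a)) (v' (J ! b)))) = ?F * ?H * det S"
      using scale[of k] S by simp
    have num: "ext_inner \<sigma> (blade (map u' I) \<^bold>\<and> blade [u' l]) (blade (map v' J) \<^bold>\<and> blade [v' p]) =
        ?F * (1 / wnorm \<sigma> (u l)) * (?H * (1 / wnorm \<sigma> (v p))) * ?M"
      unfolding inner scale using assms(6,8) by (simp add: nth_append)
    have FH: "?F \<noteq> 0" "?H \<noteq> 0"
      using nz assms(6,8) by (auto simp: nth_append)
    show "E $$ (l, p) =
        wnorm \<sigma> (u l) * wnorm \<sigma> (v p) *
        ext_inner \<sigma> (blade (map u' I) \<^bold>\<and> blade [u' l]) (blade (map v' J) \<^bold>\<and> blade [v' p]) /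
        det (mat k k (\<lambda>(a, b). winner \<sigma> (u' (I ! a)) (v' (J ! b))))"
      unfolding den num E using FH nz \<open>det S \<noteq> 0\<close> by (simp add: divide_simps)
  qed
qed

end
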